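(* Let $d \ge 0$ and $p \ge 1$ be integers, let $h$ be a vertex of $S_1$, and let $s$ be the offset index of $CM(h)$. If there exists an index $i$ (with $0 \le i < i+1 \le p(d+1)-1$) such that $i \not\equiv s \pmod p$, $h_i = 0$, and $h_{i+1} = 1$, then $h \notin C_{\mathrm{END}}$.
   Context: A vector $h \in \mathbb{R}^{p(d+1)}$ is indexed as $h = (h_0, h_1, \dots, h_{p(d+1)-1})$, and we write $h_{r,j} := h_{jp+r}$ for $0 \le r \le p-1$ and $0 \le j \le d$; the entries $h_{r,0},\dots,h_{r,d}$ form the $r$-th mod class of $h$. Put $h(z) := \sum_i h_i z^i$ and define $L_h : \mathbb{Z}_{\ge 0} \to \mathbb{R}$ by $\sum_{n \ge 0} L_h(n) z^n := h(z)/(1-z^p)^{d+1}$; equivalently, $L_h(tp+r) = \sum_{j=0}^d h_{r,j}\binom{t+d-j}{d}$ for $t \ge 0$, $0 \le r \le p-1$. For $N \in \mathbb{Z}_{\ge 0}$, let $C_N := \{h \in \mathbb{R}^{p(d+1)} : L_h(n+1) \ge L_h(n) \text{ for all integers } n \ge N\}$, let $C_{\mathrm{END}} := \bigcup_{N \ge 0} C_N$, and let $\overline{C_{\mathrm{END}}}$ be its topological closure. Define the rational polytope $$S_1 := \overline{C_{\mathrm{END}}} \cap \Big\{h \in \mathbb{R}_{\ge 0}^{p(d+1)} : \sum_{j=0}^d h_{0,j} = 1\Big\}.$$ (Every $h\in\overline{C_{\mathrm{END}}}$ has $\sum_{j} h_{r,j}$ independent of $r$, so for $h \in S_1$ all these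 sums equal $1$.) For $h \in S_1$ let $CM_r(h) := \sum_{j=0}^d j\,h_{r,j}$ and $CM(h) := (CM_0(h),\dots,CM_{p-1}(h))$. Every vertex $h$ of $S_1$ has $CM(h) \in \mathbb{Z}^p$, and whenever $h \in S_1$ has $CM(h) \in \mathbb{Z}^p$ there is an integer $k$ with $CM(h) = (k+1,\dots,k+1,k,\dots,k)$. The offset index $s$ is the unique index in $\{0,\dots,p-2\}$ with $CM_s(h) = k+1$ and $CM_{s+1}(h) = k$; if no such index exists (i.e. $CM(h)$ is constant), then $s := p-1$. *)

theory Defs
  imports
    "HOL-Analysis.Analysis"
    "HOL-Computational_Algebra.Formal_Power_Series"
    "HOL-Number_Theory.Cong"
begin

text \<open>
  Vectors indexed by \<open>0, \<dots>, p (d + 1) - 1\<close> are elements of \<open>real ^ 'n\<close> together with an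
  enumeration \<open>e\<close> of the index type, a bijection from \<open>{..<p * (d + 1)}\<close> onto \<open>UNIV :: 'n set\<close>;
  the coordinate \<open>h\<^sub>i\<close> is \<open>h $ e i\<close>. The definitions below are meant for such \<open>e\<close> and \<open>p \<ge> 1\<close>.
\<close>

definition mod_entry :: "nat \<Rightarrow> (nat \<Rightarrow> 'n) \<Rightarrow> real ^ 'n \<Rightarrow> nat \<Rightarrow> nat \<Rightarrow> real" where
  "mod_entry p e h r j = h $ e (j * p + r)"

definition h_series :: "nat \<Rightarrow> nat \<Rightarrow> (nat \<Rightarrow> 'n) \<Rightarrow> real ^ 'n \<Rightarrow> real fps" where
  "h_series p d e h = (\<Sum>i<p * (d + 1). fps_const (h $ e i) * fps_X ^ i)"

definition L_h :: "nat \<Rightarrow> nat \<Rightarrow> (nat \<Rightarrow> 'n) \<Rightarrow> real ^ 'n \<Rightarrow> nat \<Rightarrow> real" where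
  "L_h p d e h n = fps_nth (h_series p d e h / (1 - fps_X ^ p) ^ (d + 1)) n"

definition C_from :: "nat \<Rightarrow> nat \<Rightarrow> (nat \<Rightarrow> 'n) \<Rightarrow> nat \<Rightarrow> (real ^ 'n) set" where
  "C_from p d e N = {h. \<forall>n\<ge>N. L_h p d e h (n + 1) \<ge> L_h p d e h n}"

definition C_END :: "nat \<Rightarrow> nat \<Rightarrow> (nat \<Rightarrow> 'n) \<Rightarrow> (real ^ 'n) set" where
  "C_END p d e = (\<Union>N. C_from p d e N)"

definition S1 :: "nat \<Rightarrow> nat \<Rightarrow> (nat \<Rightarrow> 'n::finite) \<Rightarrow> (real ^ 'n) set" where
  "S1 p d e = closure (C_END p d e) \<inter>
     {h. (\<forall>i<p * (d + 1). h $ e i \<ge> 0) \<and> (\<Sum>j\<le>d. mod_entry p e h 0 j) = 1}"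

definition CM :: "nat \<Rightarrow> nat \<Rightarrow> (nat \<Rightarrow> 'n) \<Rightarrow> real ^ 'n \<Rightarrow> nat \<Rightarrow> real" where
  "CM p d e h r = (\<Sum>j\<le>d. real j * mod_entry p e h r j)"

definition is_offset :: "nat \<Rightarrow> (nat \<Rightarrow> real) \<Rightarrow> nat \<Rightarrow> bool" where
  "is_offset p c s \<longleftrightarrow>
     s + 1 < p \<and> (\<exists>k::int. c s = of_int (k + 1) \<and> c (s + 1) = of_int k)"

text \<open>
  If \<open>(c 0, \<dots>, c (p - 1))\<close> has the form \<open>(k + 1, \<dots>, k + 1, k, \<dots>, k)\<close> for an integer \<open>k\<close>, at most
  one \<open>s\<close> satisfies \<open>is_offset p c s\<close>, and none does iff the vector is constant.
\<close>

definition offset_index :: "nat \<Rightarrow> (nat \<Rightarrow> real) \<Rightarrow> nat" where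
  "offset_index p c = (if \<exists>s. is_offset p c s then THE s. is_offset p c s else p - 1)"

text \<open>The power series of \<open>1 / (1 - z\<^sup>p)\<^bsup>d + 1\<^esup>\<close>.\<close>

definition geom_fps :: "nat \<Rightarrow> nat \<Rightarrow> real fps" where
  "geom_fps p d = Abs_fps (\<lambda>n. if p dvd n then of_nat ((n div p + d) choose d) else 0)"

lemma geom_fps_step:
  assumes "p \<ge> 1"
  shows "geom_fps p (Suc d) * (1 - fps_X ^ p) = geom_fps p d"
proof (rule fps_ext)
  fix n
  have "fps_nth (geom_fps p (Suc d) * (1 - fps_X ^ p)) n =
      fps_nth (geom_fps p (Suc d)) n - (if n < p then 0 else fps_nth (geom_fps p (Suc d)) (n - p))"
    by (simp add: right_diff_distrib fps_X_power_mult_right_nth)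
  also have "\<dots> = fps_nth (geom_fps p d) n"
  proof (cases "n < p")
    case True
    then show ?thesis by (auto simp: geom_fps_def)
  next
    case False
    then obtain m where m: "n = m + p" by (metis add.commute le_Suc_ex not_less)
    have "p dvd m + p \<longleftrightarrow> p dvd m" by simp
    moreover have "(m + p) div p = Suc (m div p)" using assms by simp
    ultimately show ?thesis using m by (auto simp: geom_fps_def)
  qed
  finally show "fps_nth (geom_fps p (Suc d) * (1 - fps_X ^ p)) n = fps_nth (geom_fps p d) n" .
qed

lemma geom_fps_0:
  assumes "p \<ge> 1"
  shows "geom_fps p 0 * (1 - fps_X ^ p) = 1"
proof (rule fps_ext)
  fix n
  have "fps_nth (geom_fps p 0 * (1 - fps_X ^ p)) n =
      fps_nth (geom_fps p 0) n - (if n < p then 0 else fps_nth (geom_fps p 0) (n - p))"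
    by (simp add: right_diff_distrib fps_X_power_mult_right_nth)
  also have "\<dots> = fps_nth 1 n"
  proof (cases "n < p")
    case True
    then show ?thesis by (auto simp: geom_fps_def dest: dvd_imp_le)
  next
    case False
    then obtain m where m: "n = m + p" by (metis add.commute le_Suc_ex not_less)
    then show ?thesis using assms by (auto simp: geom_fps_def)
  qed
  finally show "fps_nth (geom_fps p 0 * (1 - fps_X ^ p)) n = fps_nth 1 n" .
qed

lemma geom_fps_mult:
  assumes "p \<ge> 1"
  shows "geom_fps p d * (1 - fps_X ^ p) ^ (d + 1) = 1"
proof (induction d)
  case 0
  then show ?case using geom_fps_0[OF assms] by simp
next
  case (Suc d)
  have "geom_fps p (Suc d) * (1 - fps_X ^ p) ^ (Suc d + 1) =
      (geom_fps p (Suc d) * (1 - fps_X ^ p)) * (1 - fps_X ^ p) ^ (d + 1)"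
    by (simp add: mult_ac)
  then show ?case using Suc geom_fps_step[OF assms, of d] by (simp only:)
qed

lemma L_h_eq_sum_binomial:
  assumes "p \<ge> 1" and "r < p"
  shows "L_h p d e h (t * p + r) = (\<Sum>j\<le>d. mod_entry p e h r j * of_nat ((t + d - j) choose d))"
proof -
  let ?D = "(1 - fps_X ^ p) ^ (d + 1) :: real fps"
  let ?n = "t * p + r"
  have D0: "fps_nth ?D 0 \<noteq> 0"
    using assms by (simp add: fps_power_zeroth zero_power)
  have "inverse ?D = geom_fps p d"
    using fps_inverse_unique[of ?D "geom_fps p d"] geom_fps_mult[OF assms(1), of d]
    by (simp add: mult.commute)
  then have "L_h p d e h ?n = fps_nth (h_series p d e h * geom_fps p d) ?n"
    unfolding L_h_def fps_divide_unit[OF D0] by (simp only:)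
  also have "\<dots> = (\<Sum>i<p * (d + 1). h $ e i * (if ?n < i then 0 else fps_nth (geom_fps p d) (?n - i)))"
    by (simp add: h_series_def sum_distrib_right fps_sum_nth mult.assoc fps_X_power_mult_nth
        del: mult_Suc_right)
  also have "\<dots> = (\<Sum>i\<in>(\<lambda>j. j * p + r) ` {..d}.
      h $ e i * (if ?n < i then 0 else fps_nth (geom_fps p d) (?n - i)))"
  proof (rule sum.mono_neutral_right)
    show "(\<lambda>j. j * p + r) ` {..d} \<subseteq> {..<p * (d + 1)}"
    proof safe
      fix j assume "j \<le> d"
      have "j * p + r < (j + 1) * p" using assms(2) by simp
      also have "\<dots> \<le> (d + 1) * p" using \<open>j \<le> d\<close> by (intro mult_le_mono) auto
      finally show "j * p + r < p * (d + 1)" by (simp only: mult.commute)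
    qed
    show "\<forall>i\<in>{..<p * (d + 1)} - (\<lambda>j. j * p + r) ` {..d}.
        h $ e i * (if ?n < i then 0 else fps_nth (geom_fps p d) (?n - i)) = 0"
    proof
      fix i assume i: "i \<in> {..<p * (d + 1)} - (\<lambda>j. j * p + r) ` {..d}"
      have "\<not> p dvd ?n - i" if "i \<le> ?n"
      proof
        assume "p dvd ?n - i"
        then have "[?n = i] (mod p)" using that by (simp add: cong_altdef_nat)
        then have "i mod p = r" using assms(2) by (simp add: cong_def)
        then have eq: "i = (i div p) * p + r" by (metis div_mult_mod_eq)
        have "i div p < d + 1" using i assms(1) by (simp add: less_mult_imp_div_less mult.commute)
        then have "i div p \<in> {..d}" by simp
        then show False using i eq by blast
      qed
      then show "h $ e i * (if ?n < i then 0 else fps_nth (geom_fps p d) (?n - i)) = 0"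
        by (auto simp: geom_fps_def)
    qed
  qed simp
  also have "\<dots> = (\<Sum>j\<le>d. h $ e (j * p + r) *
      (if ?n < j * p + r then 0 else fps_nth (geom_fps p d) (?n - (j * p + r))))"
    using assms(1) by (subst sum.reindex) (auto simp: inj_on_def)
  also have "\<dots> = (\<Sum>j\<le>d. mod_entry p e h r j * of_nat ((t + d - j) choose d))"
  proof (rule sum.cong)
    fix j assume "j \<in> {..d}"
    then have jd: "j \<le> d" by simp
    show "h $ e (j * p + r) *
        (if ?n < j * p + r then 0 else fps_nth (geom_fps p d) (?n - (j * p + r))) =
        mod_entry p e h r j * of_nat ((t + d - j) choose d)"
    proof (cases "t < j")
      case True
      then have "t + d - j < d" using jd by linarith
      then show ?thesis using assms(1) True by (simp add: mod_entry_def)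
    next
      case False
      have "?n - (j * p + r) = (t - j) * p" by (simp add: diff_mult_distrib)
      moreover have "\<not> ?n < j * p + r" using False by simp
      moreover have "t - j + d = t + d - j" using False by simp
      ultimately show ?thesis using assms(1) by (simp add: geom_fps_def mod_entry_def)
    qed
  qed simp
  finally show ?thesis .
qed

end

theory Submission
  imports Defs "HOL-Real_Asymp.Real_Asymp"
begin

text \<open>
  As polynomials in \<open>t\<close>, the differences \<open>L_h(tp + r + 1) - L_h(tp + r)\<close> have top coefficients given
  by the differences of the successive binomial moments of the mod classes: total mass, mean,
  variance. In \<open>S1\<close> the masses agree and the means decrease weakly along one period by a total
  of 1; at a vertex the means are integers, so the only strict drop is at the offset index. Away from
  it the means of the two consecutive classes agree. The entries \<open>h\<^sub>i = 0\<close>, \<open>h\<^sub>i\<^sub>+\<^sub>1 = 1\<close> then say that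
  the second class is the point mass at the mean while the first has positive variance, and the
  convexity of the binomial coefficient in its shift forces infinitely many strict descents.
\<close>

section \<open>Asymptotics of combinations of binomial coefficients\<close>

text \<open>For \<open>t \<ge> m\<close> the binomial coefficient is a product of \<open>d\<close>
  linear factors in \<open>t\<close> over \<open>fact d\<close>, and the shift \<open>m\<close> is
  invisible in the leading term.\<close>

lemma binomial_shift_tendsto:
  "(\<lambda>t. real ((t + d - m) choose d) / real t ^ d) \<longlonglongrightarrow> 1 / fact d"
proof -
  have "(\<lambda>t. (\<Prod>i<d. (real t + (real d - real m - real i)) / real t) / fact d)
      \<longlonglongrightarrow> (\<Prod>i<d. 1) / fact d"
  proof (intro tendsto_intros)
    fix i
    show "(\<lambda>t. (real t + (real d - real m - real i)) / real t) \<longlonglongrightarrow> 1"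
      by real_asymp
  qed simp
  then have "(\<lambda>t. (\<Prod>i<d. (real t + (real d - real m - real i)) / real t) / fact d)
      \<longlonglongrightarrow> 1 / fact d" by simp
  moreover have "\<forall>\<^sub>F t in sequentially.
      (\<Prod>i<d. (real t + (real d - real m - real i)) / real t) / fact d
      = real ((t + d - m) choose d) / real t ^ d"
    using eventually_ge_at_top[of m]
  proof eventually_elim
    case (elim t)
    have "real ((t + d - m) choose d) = (\<Prod>i<d. real t + (real d - real m - real i)) / fact d"
      using elim by (simp add: binomial_gbinomial gbinomial_prod_rev atLeast0LessThan
          of_nat_diff algebra_simps)
    then show ?case by (simp add: prod_dividef)
  qed
  ultimately show ?thesis by (rule Lim_transform_eventually)
qed

lemma sum_choose_less: "(\<Sum>i<m. i choose k) = m choose Suc k"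
  by (induction m) auto

lemma sum_mult_lessThan_swap:
  fixes c f :: "nat \<Rightarrow> real"
  shows "(\<Sum>m\<le>M. c m * (\<Sum>i<m. f i)) = (\<Sum>i\<le>M. (\<Sum>m\<in>{i<..M}. c m) * f i)"
proof -
  have "(\<Sum>m\<le>M. c m * (\<Sum>i<m. f i)) = (\<Sum>m\<le>M. \<Sum>i\<le>M. if i < m then c m * f i else 0)"
  proof (rule sum.cong)
    fix m assume "m \<in> {..M}"
    then have "{..M} \<inter> {i. i < m} = {..<m}" by auto
    then show "c m * (\<Sum>i<m. f i) = (\<Sum>i\<le>M. if i < m then c m * f i else 0)"
      by (simp add: sum.If_cases sum_distrib_left)
  qed simp
  also have "\<dots> = (\<Sum>i\<le>M. \<Sum>m\<le>M. if i < m then c m * f i else 0)"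
    by (rule sum.swap)
  also have "\<dots> = (\<Sum>i\<le>M. (\<Sum>m\<in>{i<..M}. c m) * f i)"
  proof (rule sum.cong)
    fix i assume "i \<in> {..M}"
    have "{..M} \<inter> {m. i < m} = {i<..M}" by auto
    then show "(\<Sum>m\<le>M. if i < m then c m * f i else 0) = (\<Sum>m\<in>{i<..M}. c m) * f i"
      by (simp add: sum.If_cases sum_distrib_right)
  qed simp
  finally show ?thesis .
qed

text \<open>Pascal's rule, telescoped over \<open>m\<close> steps; \<open>m \<le> t\<close> makes
  every natural subtraction exact.\<close>

lemma binomial_shift_diff:
  assumes "m \<le> t"
  shows "real ((t + Suc d - m) choose Suc d)
    = real ((t + Suc d) choose Suc d) - (\<Sum>i<m. real ((t + d - i) choose d))"
  using assms
proof (induction m)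
  case (Suc m)
  then have "t + Suc d - m = Suc (t + d - m)" "t + Suc d - Suc m = t + d - m" by auto
  then show ?case using Suc by simp
qed simp

text \<open>Summation by parts turns the weights \<open>c\<close> into their tail sums, which lowers \<open>d\<close> and the
  order \<open>k\<close> of the first non-vanishing binomial moment by one.\<close>

lemma binomial_combination_tendsto:
  fixes c :: "nat \<Rightarrow> real"
  assumes "k \<le> d" and "\<And>i. i < k \<Longrightarrow> (\<Sum>m\<le>M. real (m choose i) * c m) = 0"
  shows "(\<lambda>t. (\<Sum>m\<le>M. c m * real ((t + d - m) choose d)) / real t ^ (d - k))
    \<longlonglongrightarrow> (- 1) ^ k * (\<Sum>m\<le>M. real (m choose k) * c m) / fact (d - k)"
  using assms
proof (induction k arbitrary: c d)
  case 0
  have "(\<lambda>t. \<Sum>m\<le>M. c m * (real ((t + d - m) choose d) / real t ^ d))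
      \<longlonglongrightarrow> (\<Sum>m\<le>M. c m * (1 / fact d))"
    by (intro tendsto_intros binomial_shift_tendsto)
  then show ?case by (simp add: sum_divide_distrib)
next
  case (Suc k)
  obtain d' where d: "d = Suc d'" "k \<le> d'" using Suc.prems(1) by (cases d) auto
  define b where "b i = (\<Sum>m\<in>{i<..M}. c m)" for i
  have c0: "(\<Sum>m\<le>M. c m) = 0" using Suc.prems(2)[of 0] by simp
  \<comment> \<open>By the hockey-stick identity, passing to tail sums lowers the order of a
    binomial moment by one.\<close>
  have mom: "(\<Sum>i\<le>M. real (i choose j) * b i) = (\<Sum>m\<le>M. real (m choose Suc j) * c m)" for j
  proof -
    have "(\<Sum>i\<le>M. real (i choose j) * b i) = (\<Sum>m\<le>M. c m * (\<Sum>i<m. real (i choose j)))"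
      unfolding sum_mult_lessThan_swap b_def by (simp add: mult.commute)
    also have "\<dots> = (\<Sum>m\<le>M. real (m choose Suc j) * c m)"
      unfolding of_nat_sum[symmetric] sum_choose_less by (simp add: mult.commute)
    finally show ?thesis .
  qed
  have "(\<lambda>t. (\<Sum>m\<le>M. b m * real ((t + d' - m) choose d')) / real t ^ (d' - k))
      \<longlonglongrightarrow> (- 1) ^ k * (\<Sum>m\<le>M. real (m choose k) * b m) / fact (d' - k)"
  proof (rule Suc.IH[OF d(2)])
    fix i assume "i < k"
    then show "(\<Sum>m\<le>M. real (m choose i) * b m) = 0"
      unfolding mom using Suc.prems(2)[of "Suc i"] by simp
  qed
  then have "(\<lambda>t. - ((\<Sum>m\<le>M. b m * real ((t + d' - m) choose d')) / real t ^ (d' - k)))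
      \<longlonglongrightarrow> - ((- 1) ^ k * (\<Sum>m\<le>M. real (m choose k) * b m) / fact (d' - k))"
    by (rule tendsto_minus)
  moreover have "\<forall>\<^sub>F t in sequentially.
      - ((\<Sum>m\<le>M. b m * real ((t + d' - m) choose d')) / real t ^ (d' - k))
      = (\<Sum>m\<le>M. c m * real ((t + d - m) choose d)) / real t ^ (d - Suc k)"
    using eventually_ge_at_top[of M]
  proof eventually_elim
    case (elim t)
    have "(\<Sum>m\<le>M. c m * real ((t + d - m) choose d))
        = (\<Sum>m\<le>M. c m * real ((t + d) choose d) - c m * (\<Sum>i<m. real ((t + d' - i) choose d')))"
    proof (rule sum.cong)
      fix m assume "m \<in> {..M}"
      then have "m \<le> t" using elim by simp
      from binomial_shift_diff[OF this, of d']
      show "c m * real ((t + d - m) choose d)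
        = c m * real ((t + d) choose d) - c m * (\<Sum>i<m. real ((t + d' - i) choose d'))"
        unfolding d(1) by (simp only: right_diff_distrib)
    qed simp
    \<comment> \<open>The common term drops out because the total weight is zero. The minus sign
      left over, one per unit of \<open>k\<close>, builds up \<open>(- 1) ^ k\<close>.\<close>
    also have "\<dots> = - (\<Sum>m\<le>M. b m * real ((t + d' - m) choose d'))"
      unfolding sum_subtractf sum_distrib_right[symmetric] c0 sum_mult_lessThan_swap b_def by simp
    finally show ?case by (simp add: d(1))
  qed
  ultimately have "(\<lambda>t. (\<Sum>m\<le>M. c m * real ((t + d - m) choose d)) / real t ^ (d - Suc k))
      \<longlonglongrightarrow> - ((- 1) ^ k * (\<Sum>m\<le>M. real (m choose k) * b m) / fact (d' - k))"
    by (rule Lim_transform_eventually)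
  then show ?case by (simp add: d(1) mom)
qed

text \<open>A limit of eventually nonnegative quotients is nonnegative, which fixes the weak sign of
  the first moment not assumed to vanish.\<close>

lemma binomial_combination_nonneg_imp:
  fixes c :: "nat \<Rightarrow> real"
  assumes "k \<le> d" and "\<And>i. i < k \<Longrightarrow> (\<Sum>m\<le>M. real (m choose i) * c m) = 0"
    and "\<forall>\<^sub>F t in sequentially. 0 \<le> (\<Sum>m\<le>M. c m * real ((t + d - m) choose d))"
  shows "0 \<le> (- 1) ^ k * (\<Sum>m\<le>M. real (m choose k) * c m)"
proof -
  have "0 \<le> (- 1) ^ k * (\<Sum>m\<le>M. real (m choose k) * c m) / fact (d - k)"
    by (rule tendsto_lowerbound[OF binomial_combination_tendsto[OF assms(1,2)]])
      (use assms(3) in \<open>auto elim: eventually_mono\<close>)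
  from mult_nonneg_nonneg[OF this, of "fact (d - k)"] show ?thesis by simp
qed

lemma binomial_combination_eventually_pos:
  fixes c :: "nat \<Rightarrow> real"
  assumes "k \<le> d" and "\<And>i. i < k \<Longrightarrow> (\<Sum>m\<le>M. real (m choose i) * c m) = 0"
    and "0 < (- 1) ^ k * (\<Sum>m\<le>M. real (m choose k) * c m)"
  shows "\<forall>\<^sub>F t in sequentially. 0 < (\<Sum>m\<le>M. c m * real ((t + d - m) choose d))"
proof -
  have "0 < (- 1) ^ k * (\<Sum>m\<le>M. real (m choose k) * c m) / fact (d - k)"
    using assms(3) by simp
  from order_tendstoD(1)[OF binomial_combination_tendsto[OF assms(1,2)] this]
  have "\<forall>\<^sub>F t in sequentially.
    0 < (\<Sum>m\<le>M. c m * real ((t + d - m) choose d)) / real t ^ (d - k)" by simp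
  then show ?thesis using eventually_gt_at_top[of 0]
    by eventually_elim (simp add: zero_less_divide_iff)
qed

section \<open>Ingredients for perturbing a vertex\<close>

text \<open>Unit mass on a single index has that index, an integer, as its mean.\<close>

lemma two_support_points:
  fixes q :: "nat \<Rightarrow> real"
  assumes nonneg: "\<And>j. j \<le> d \<Longrightarrow> 0 \<le> q j" and sum1: "(\<Sum>j\<le>d. q j) = 1"
    and nonint: "(\<Sum>j\<le>d. real j * q j) \<notin> \<int>"
  shows "\<exists>a b. a \<noteq> b \<and> a \<le> d \<and> b \<le> d \<and> 0 < q a \<and> 0 < q b"
proof (rule ccontr)
  assume neg: "\<not> ?thesis"
  obtain a where a: "a \<le> d" "q a \<noteq> 0"
    using sum1 by (metis atMost_iff sum.neutral zero_neq_one)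
  then have "q j = 0" if "j \<le> d" "j \<noteq> a" for j
    using neg nonneg[of a] nonneg[of j] that by (auto simp: order_le_less)
  then have "(\<Sum>j\<le>d. g j * q j) = (\<Sum>j\<in>{a}. g j * q j)" for g
    using a(1) by (intro sum.mono_neutral_right) auto
  then have q: "(\<Sum>j\<le>d. g j * q j) = g a * q a" for g by simp
  have "q a = 1" using q[of "\<lambda>_. 1"] sum1 by simp
  then show False using nonint q[of real] by simp
qed

text \<open>Slack inequalities survive small perturbations of both signs; tight ones survive when
  the direction does not change them. At a vertex this serves both the entries and the moment
  inequalities.\<close>

lemma eventually_perturbation_nonneg:
  fixes x y :: real
  assumes "0 \<le> x" and "x = 0 \<Longrightarrow> y = 0"
  shows "\<forall>\<^sub>F t in at_right 0. 0 \<le> x + t * y \<and> 0 \<le> x - t * y"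
proof (cases "x = 0")
  case False
  then have "0 < x" using assms(1) by simp
  have "((\<lambda>t. x + t * y) \<longlongrightarrow> x + 0 * y) (at_right 0)" "((\<lambda>t. x - t * y) \<longlongrightarrow> x - 0 * y) (at_right 0)"
    by (intro tendsto_intros)+
  then have "\<forall>\<^sub>F t in at_right 0. 0 < x + t * y" "\<forall>\<^sub>F t in at_right 0. 0 < x - t * y"
    using \<open>0 < x\<close> by (auto dest: order_tendstoD(1))
  then show ?thesis by eventually_elim auto
qed (use assms in simp)

section \<open>Residue classes and their moments\<close>

locale indexed_space =
  fixes p d :: nat and e :: "nat \<Rightarrow> 'n::finite"
  assumes p_pos: "p \<ge> 1" and e_bij: "bij_betw e {..<p * (d + 1)} UNIV"
begin

text \<open>The weight \<open>ent h r m\<close> is the coefficient of \<open>z\<^bsup>(m - 1) p + r\<^esup>\<close> in \<open>h(z)\<close>. Allowing \<open>r = p\<close>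
  makes the step from class \<open>p - 1\<close> to class \<open>0\<close> look like any other step.\<close>

definition ent :: "real ^ 'n \<Rightarrow> nat \<Rightarrow> nat \<Rightarrow> real" where
  "ent h r m = (if r = p then (if m \<le> d then mod_entry p e h 0 m else 0)
     else (case m of 0 \<Rightarrow> 0 | Suc j \<Rightarrow> mod_entry p e h r j))"

text \<open>Binomial moments, unlike power moments, are carried to each other by summation by parts.
  The range ends at \<open>Suc d\<close> because the classes \<open>r < p\<close> are shifted up by
  one place.\<close>

definition moment :: "nat \<Rightarrow> real ^ 'n \<Rightarrow> nat \<Rightarrow> real" where
  "moment k h r = (\<Sum>m\<le>Suc d. real (m choose k) * ent h r m)"

lemma ent_add: "ent (g + h) r m = ent g r m + ent h r m"
  and ent_scaleR: "ent (x *\<^sub>R h) r m = x * ent h r m"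
  by (auto simp: ent_def mod_entry_def split: nat.split)

lemma moment_add: "moment k (g + h) r = moment k g r + moment k h r"
  and moment_scaleR: "moment k (x *\<^sub>R h) r = x * moment k h r"
  by (auto simp: moment_def ent_add ent_scaleR sum.distrib algebra_simps sum_distrib_left)

lemma continuous_on_moment: "continuous_on A (\<lambda>h. moment k h r)"
proof -
  have "continuous_on A (\<lambda>h. ent h r m)" for m
    by (cases m; cases "r = p"; cases "m \<le> d")
      (auto simp: ent_def mod_entry_def intro!: continuous_intros)
  then show ?thesis unfolding moment_def by (intro continuous_intros)
qed

lemma moment_0_class: "r < p \<Longrightarrow> moment 0 h r = (\<Sum>j\<le>d. mod_entry p e h r j)"
  unfolding moment_def sum.atMost_Suc_shift by (simp add: ent_def)

lemma moment_0_p: "moment 0 h p = moment 0 h 0"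
  using p_pos by (simp add: moment_0_class) (simp add: moment_def ent_def)

text \<open>The shift by one place adds the total mass to the mean. Class \<open>p\<close> is not
  shifted, so over a full period the first moment falls by exactly the mass of class
  \<open>0\<close>.\<close>

lemma moment_1_class: "r < p \<Longrightarrow> moment 1 h r = CM p d e h r + moment 0 h r"
  unfolding moment_0_class CM_def moment_def sum.atMost_Suc_shift
  by (simp add: ent_def algebra_simps sum.distrib)

lemma moment_1_p: "moment 1 h p = CM p d e h 0"
  by (simp add: moment_def ent_def CM_def)

text \<open>For \<open>r < p\<close> the shifted weights compensate for \<open>Suc t\<close> in
  place of \<open>t\<close>; for \<open>r = p\<close> the argument is \<open>Suc t * p + 0\<close>,
  which lies in class \<open>0\<close>.\<close>

lemma L_h_eq_ent:
  assumes "r \<le> p"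
  shows "L_h p d e h (t * p + r) = (\<Sum>m\<le>Suc d. ent h r m * real ((Suc t + d - m) choose d))"
proof (cases "r = p")
  case True
  have "L_h p d e h (Suc t * p + 0) = (\<Sum>m\<le>d. mod_entry p e h 0 m * real ((Suc t + d - m) choose d))"
    using L_h_eq_sum_binomial[of p 0 d e h "Suc t"] p_pos by simp
  moreover have "Suc t * p + 0 = t * p + r" using True by simp
  ultimately have "L_h p d e h (t * p + r)
      = (\<Sum>m\<le>d. mod_entry p e h 0 m * real ((Suc t + d - m) choose d))" by (simp only:)
  then show ?thesis using True by (simp add: ent_def)
next
  case False
  then show ?thesis
    unfolding sum.atMost_Suc_shift
    using L_h_eq_sum_binomial[of p r d e h t] p_pos assms by (simp add: ent_def)
qed

text \<open>The steps from \<open>n\<close> to \<open>n + 1\<close> are sorted by the residue of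
  \<open>n\<close>. There are finitely many residues, so a common threshold exists once each has its
  own.\<close>

lemma C_END_iff:
  "h \<in> C_END p d e \<longleftrightarrow> (\<forall>r<p. \<forall>\<^sub>F t in sequentially.
     0 \<le> (\<Sum>m\<le>Suc d. (ent h (Suc r) m - ent h r m) * real ((t + d - m) choose d)))"
    (is "_ \<longleftrightarrow> (\<forall>r<p. eventually (?Q r) sequentially)")
proof -
  let ?P = "\<lambda>n. L_h p d e h n \<le> L_h p d e h (Suc n)"
  have step: "?P (t * p + r) \<longleftrightarrow> ?Q r (Suc t)" if "r < p" for r t
    using L_h_eq_ent[of r h t] L_h_eq_ent[of "Suc r" h t] that
    by (simp add: left_diff_distrib sum_subtractf)
  have "h \<in> C_END p d e \<longleftrightarrow> eventually ?P sequentially"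
    by (simp add: C_END_def C_from_def eventually_sequentially)
  also have "\<dots> \<longleftrightarrow> (\<forall>r<p. \<forall>\<^sub>F t in sequentially. ?P (t * p + r))"
  proof (intro iffI allI impI)
    fix r assume P: "eventually ?P sequentially" and "r < p"
    have "filterlim (\<lambda>t. t * p + r) sequentially sequentially"
    proof (rule filterlim_at_top_mono[OF filterlim_ident])
      have "t \<le> t * p + r" for t using mult_le_mono2[OF p_pos, of t] by linarith
      then show "\<forall>\<^sub>F t in sequentially. t \<le> t * p + r" by simp
    qed
    then show "\<forall>\<^sub>F t in sequentially. ?P (t * p + r)"
      using P unfolding filterlim_iff by blast
  next
    assume "\<forall>r<p. \<forall>\<^sub>F t in sequentially. ?P (t * p + r)"
    then have "\<forall>\<^sub>F t in sequentially. \<forall>r\<in>{..<p}. ?P (t * p + r)"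
      by (intro eventually_ball_finite) auto
    then obtain N where N: "\<And>t r. N \<le> t \<Longrightarrow> r < p \<Longrightarrow> ?P (t * p + r)"
      unfolding eventually_sequentially by blast
    have "?P n" if "N * p \<le> n" for n
    proof -
      have "N \<le> n div p" using that p_pos by (simp add: less_eq_div_iff_mult_less_eq)
      moreover have "n mod p < p" using p_pos by simp
      ultimately have "?P (n div p * p + n mod p)" by (rule N)
      then show ?thesis by simp
    qed
    then show "eventually ?P sequentially" unfolding eventually_sequentially by blast
  qed
  also have "\<dots> \<longleftrightarrow> (\<forall>r<p. \<forall>\<^sub>F t in sequentially. ?Q r (Suc t))"
    using step by simp
  also have "\<dots> \<longleftrightarrow> (\<forall>r<p. eventually (?Q r) sequentially)"
    by (simp only: eventually_sequentially_Suc[where P="?Q _"])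
  finally show ?thesis .
qed

lemma moment_diff:
  "(\<Sum>m\<le>Suc d. real (m choose k) * (ent h (Suc r) m - ent h r m)) = moment k h (Suc r) - moment k h r"
  unfolding moment_def by (simp only: right_diff_distrib sum_subtractf)

section \<open>The closure of the cone of eventually nondecreasing functions\<close>

text \<open>For \<open>d \<ge> 1\<close> these linear conditions cut out the closure of
  \<open>C_END p d e\<close>, as shown below. The guard \<open>1 \<le> d\<close> reflects that for
  \<open>d = 0\<close> there is no coefficient of order \<open>d - 1\<close>.\<close>

definition balanced :: "real ^ 'n \<Rightarrow> bool" where
  "balanced h \<longleftrightarrow> (\<forall>r<p. moment 0 h (Suc r) = moment 0 h r \<and>
     (1 \<le> d \<longrightarrow> moment 1 h (Suc r) \<le> moment 1 h r))"

lemma C_END_imp_balanced: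
  assumes "h \<in> C_END p d e"
  shows "balanced h"
proof -
  have ge: "0 \<le> moment 0 h (Suc r) - moment 0 h r" if "r < p" for r
    using binomial_combination_nonneg_imp[where k=0 and d=d and M="Suc d" and c="\<lambda>m. ent h (Suc r) m - ent h r m"]
      assms that unfolding C_END_iff moment_diff by simp
  \<comment> \<open>Nonnegative increments around a full period add up to zero, so each of them
    vanishes and the next coefficient decides.\<close>
  have "(\<Sum>r<p. moment 0 h (Suc r) - moment 0 h r) = 0"
    by (simp add: sum_lessThan_telescope moment_0_p)
  then have eq: "moment 0 h (Suc r) = moment 0 h r" if "r < p" for r
    using ge that sum_nonneg_eq_0_iff[of "{..<p}" "\<lambda>r. moment 0 h (Suc r) - moment 0 h r"] by simp
  have "moment 1 h (Suc r) \<le> moment 1 h r" if "r < p" "1 \<le> d" for r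
    using binomial_combination_nonneg_imp[where k=1 and d=d and M="Suc d" and c="\<lambda>m. ent h (Suc r) m - ent h r m"]
      assms that eq[OF that(1)] unfolding C_END_iff moment_diff by simp
  with eq show ?thesis by (simp add: balanced_def)
qed

lemma closed_balanced: "closed (Collect balanced)"
  unfolding balanced_def
  by (intro closed_Collect_all closed_Collect_imp closed_Collect_conj closed_Collect_eq
      closed_Collect_le continuous_on_moment open_Collect_const)

lemma closure_C_END_imp_balanced: "h \<in> closure (C_END p d e) \<Longrightarrow> balanced h"
  using closure_minimal[OF _ closed_balanced, of "C_END p d e"] C_END_imp_balanced by blast

text \<open>With equal masses, the strict drop gives every step a positive coefficient at order
  \<open>d - 1\<close>.\<close>

lemma strictly_balanced_imp_C_END:
  assumes "1 \<le> d" and "\<And>r. r < p \<Longrightarrow> moment 0 h (Suc r) = moment 0 h r"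
    and "\<And>r. r < p \<Longrightarrow> moment 1 h (Suc r) < moment 1 h r"
  shows "h \<in> C_END p d e"
  unfolding C_END_iff
proof (intro allI impI)
  fix r assume r: "r < p"
  have "\<forall>\<^sub>F t in sequentially.
      0 < (\<Sum>m\<le>Suc d. (ent h (Suc r) m - ent h r m) * real ((t + d - m) choose d))"
    using binomial_combination_eventually_pos[where k=1 and d=d and M="Suc d"
        and c="\<lambda>m. ent h (Suc r) m - ent h r m"] assms(1) assms(2,3)[OF r]
    unfolding moment_diff by simp
  then show "\<forall>\<^sub>F t in sequentially.
      0 \<le> (\<Sum>m\<le>Suc d. (ent h (Suc r) m - ent h r m) * real ((t + d - m) choose d))"
    by (rule eventually_mono) simp
qed

lemma index_less: "r < p \<Longrightarrow> j \<le> d \<Longrightarrow> j * p + r < p * (d + 1)"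
proof -
  assume "r < p" "j \<le> d"
  then have "j * p + r < Suc j * p" by simp
  also have "\<dots> \<le> Suc d * p" using \<open>j \<le> d\<close> by (intro mult_le_mono1) simp
  finally show ?thesis by (simp add: mult.commute)
qed

lemma exists_mod_entry:
  obtains v :: "real ^ 'n" where "\<And>r j. r < p \<Longrightarrow> j \<le> d \<Longrightarrow> mod_entry p e v r j = f r j"
proof
  let ?i = "inv_into {..<p * (d + 1)} e"
  let ?v = "\<chi> x. f (?i x mod p) (?i x div p)"
  fix r j assume "r < p" "j \<le> d"
  moreover from this have "?i (e (j * p + r)) = j * p + r"
    using e_bij index_less[of r j]
    by (intro inv_into_f_f) (auto simp: bij_betw_def)
  ultimately show "mod_entry p e ?v r j = f r j" by (simp add: mod_entry_def)
qed

lemma exists_strictly_balanced: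
  assumes "1 \<le> d"
  obtains w :: "real ^ 'n" where "\<And>r. r < p \<Longrightarrow> moment 0 w (Suc r) = moment 0 w r"
    and "\<And>r. r < p \<Longrightarrow> moment 1 w (Suc r) < moment 1 w r"
proof -
  \<comment> \<open>Each class gets mass 1 and mean \<open>- r / p\<close>, so
    \<open>moment 1\<close> falls linearly from 1 to 0 as \<open>r\<close> goes from
    \<open>0\<close> to \<open>p\<close>. The negative entries are harmless, as \<open>w\<close>
    only serves as a direction.\<close>
  obtain w :: "real ^ 'n" where w: "\<And>r j. r < p \<Longrightarrow> j \<le> d \<Longrightarrow> mod_entry p e w r j
      = (if j = 0 then 1 + real r / real p else 0) + (if j = 1 then - real r / real p else 0)"
    by (rule exists_mod_entry[of "\<lambda>r j. (if j = 0 then 1 + real r / real p else 0)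
        + (if j = 1 then - real r / real p else 0)"]) blast
  have m0: "moment 0 w r = 1" if "r \<le> p" for r
  proof -
    have "moment 0 w r = 1" if "r < p" for r
      using assms that by (simp add: moment_0_class w sum.distrib)
    then show ?thesis using that p_pos by (cases "r = p") (simp_all add: moment_0_p)
  qed
  have m1: "moment 1 w r = 1 - real r / real p" if "r \<le> p" for r
  proof -
    have c: "CM p d e w r = - real r / real p" if "r < p" for r
    proof -
      have "CM p d e w r = (\<Sum>j\<le>d. if j = 1 then - real r / real p else 0)"
        unfolding CM_def by (rule sum.cong) (use that in \<open>auto simp: w\<close>)
      then show ?thesis using assms by simp
    qed
    show ?thesis using that p_pos c[of r] c[of 0] m0[of r]
      by (cases "r = p") (simp_all add: moment_1_p moment_1_class del: One_nat_def)
  qed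
  show ?thesis
    by (rule that[of w]) (use p_pos in \<open>auto simp: m0 m1 divide_strict_right_mono simp del: One_nat_def\<close>)
qed

text \<open>Adding vanishing positive multiples of a strictly balanced direction makes every weak
  inequality strict.\<close>

lemma balanced_imp_closure_C_END:
  assumes "1 \<le> d" and "balanced h"
  shows "h \<in> closure (C_END p d e)"
proof -
  obtain w :: "real ^ 'n" where w: "\<And>r. r < p \<Longrightarrow> moment 0 w (Suc r) = moment 0 w r"
    "\<And>r. r < p \<Longrightarrow> moment 1 w (Suc r) < moment 1 w r"
    using exists_strictly_balanced[OF assms(1)] by blast
  define g where "g n = h + inverse (real (Suc n)) *\<^sub>R w" for n
  have "g n \<in> C_END p d e" for n
  proof (rule strictly_balanced_imp_C_END[OF assms(1)])
    fix r assume r: "r < p"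
    show "moment 0 (g n) (Suc r) = moment 0 (g n) r"
      using assms r w by (simp add: g_def moment_add moment_scaleR balanced_def)
    have "inverse (real (Suc n)) * moment 1 w (Suc r) < inverse (real (Suc n)) * moment 1 w r"
      using w(2)[OF r] by (intro mult_strict_left_mono) auto
    then show "moment 1 (g n) (Suc r) < moment 1 (g n) r"
      using assms r by (simp add: g_def moment_add moment_scaleR balanced_def add_le_less_mono)
  qed
  moreover have "g \<longlonglongrightarrow> h + 0 *\<^sub>R w"
    unfolding g_def by (intro tendsto_intros LIMSEQ_inverse_real_of_nat)
  ultimately show ?thesis unfolding closure_sequential by auto
qed


section \<open>Vertices\<close>

lemma S1_D:
  assumes "h \<in> S1 p d e"
  shows "balanced h" and "\<And>r j. r < p \<Longrightarrow> j \<le> d \<Longrightarrow> 0 \<le> mod_entry p e h r j"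
    and "\<And>r. r \<le> p \<Longrightarrow> moment 0 h r = 1"
proof -
  show bal: "balanced h" using assms closure_C_END_imp_balanced by (simp add: S1_def)
  show "0 \<le> mod_entry p e h r j" if "r < p" "j \<le> d" for r j
    using assms index_less[OF that] by (simp add: S1_def mod_entry_def)
  show "moment 0 h r = 1" if "r \<le> p" for r
    using that
  proof (induction r)
    case 0
    then show ?case using assms p_pos by (simp add: S1_def moment_0_class)
  next
    case (Suc r)
    then show ?case using bal by (simp add: balanced_def)
  qed
qed

lemma S1_I:
  assumes "1 \<le> d" and "balanced h" and "\<And>r j. r < p \<Longrightarrow> j \<le> d \<Longrightarrow> 0 \<le> mod_entry p e h r j"
    and "moment 0 h 0 = 1"
  shows "h \<in> S1 p d e"
proof -
  have "0 \<le> h $ e i" if "i < p * (d + 1)" for i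
  proof -
    have "i div p \<le> d" using that by (simp add: less_mult_imp_div_less mult.commute flip: less_Suc_eq_le)
    then have "0 \<le> mod_entry p e h (i mod p) (i div p)" using p_pos by (intro assms(3)) auto
    then show ?thesis by (simp add: mod_entry_def)
  qed
  then show ?thesis
    using assms p_pos balanced_imp_closure_C_END by (simp add: S1_def moment_0_class)
qed

lemma moment_1_antimono:
  assumes "balanced h" "1 \<le> d" "a \<le> b" "b \<le> p"
  shows "moment 1 h b \<le> moment 1 h a"
  using assms(3,4)
proof (induction b rule: dec_induct)
  case (step n)
  then have "moment 1 h (Suc n) \<le> moment 1 h n" using assms(1,2) by (simp add: balanced_def)
  with step show ?case by simp
qed simp

text \<open>If \<open>CM h r0\<close> is not an integer, then all classes whose first moment has the same fractional
  part can be shifted simultaneously by \<open>\<plusminus>\<epsilon>\<close>: each of them carries mass at two places, and the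
  tight constraints only relate classes with equal fractional part.\<close>

lemma extreme_point_CM_in_Ints:
  assumes h: "h extreme_point_of S1 p d e" and d: "1 \<le> d" and r0: "r0 < p"
  shows "CM p d e h r0 \<in> \<int>"
proof (rule ccontr)
  assume nonint: "CM p d e h r0 \<notin> \<int>"
  have hS: "h \<in> S1 p d e" using h by (simp add: extreme_point_of_def)
  note S = S1_D[OF hS]
  define R where "R r \<longleftrightarrow> CM p d e h r - CM p d e h r0 \<in> \<int>" for r
  have "\<exists>a b. a \<noteq> b \<and> a \<le> d \<and> b \<le> d \<and> 0 < mod_entry p e h r a \<and> 0 < mod_entry p e h r b"
    if "r < p" "R r" for r
  proof (rule two_support_points)
    show "0 \<le> mod_entry p e h r j" if "j \<le> d" for j using S(2) \<open>r < p\<close> that by simp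
    show "(\<Sum>j\<le>d. mod_entry p e h r j) = 1" using S(3)[of r] that by (simp add: moment_0_class)
    have "CM p d e h r \<notin> \<int>"
    proof
      assume "CM p d e h r \<in> \<int>"
      from Ints_diff[OF this that(2)[unfolded R_def]] show False using nonint by simp
    qed
    then show "(\<Sum>j\<le>d. real j * mod_entry p e h r j) \<notin> \<int>" by (simp add: CM_def)
  qed
  then obtain a b where ab: "\<And>r. r < p \<Longrightarrow> R r \<Longrightarrow> a r \<noteq> b r \<and> a r \<le> d \<and> b r \<le> d
      \<and> 0 < mod_entry p e h r (a r) \<and> 0 < mod_entry p e h r (b r)" by metis
  \<comment> \<open>Mass is moved between \<open>a r\<close> and \<open>b r\<close>; the signed
    denominator makes the mean grow at rate exactly 1 whichever index is larger, while the total
    mass stays fixed.\<close>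
  define f where "f r j = (if R r then ((if j = b r then 1 else 0) - (if j = a r then 1 else 0))
      / (real (b r) - real (a r)) else 0)" for r j
  obtain v :: "real ^ 'n" where v: "\<And>r j. r < p \<Longrightarrow> j \<le> d \<Longrightarrow> mod_entry p e v r j = f r j"
    by (rule exists_mod_entry[of f]) blast
  have v0_class: "moment 0 v r = 0" if "r < p" for r
    using that ab[OF that]
    by (cases "R r") (simp_all add: moment_0_class v f_def sum_subtractf flip: sum_divide_distrib)
  then have v0: "moment 0 v r = 0" if "r \<le> p" for r
    using that p_pos by (cases "r = p") (simp_all add: moment_0_p)
  have CMv: "CM p d e v r = (if R r then 1 else 0)" if r: "r < p" for r
  proof (cases "R r")
    case True
    have "CM p d e v r = (\<Sum>j\<le>d. (if j = b r then real j else 0) - (if j = a r then real j else 0))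
        / (real (b r) - real (a r))"
      unfolding CM_def sum_divide_distrib using True r by (intro sum.cong) (auto simp: v f_def)
    then show ?thesis using ab[OF r True] True by (simp add: sum_subtractf)
  qed (use r in \<open>simp add: CM_def v f_def\<close>)
  have v1_eq: "moment 1 v (Suc r) = moment 1 v r" if "r < p" "moment 1 h (Suc r) = moment 1 h r" for r
  proof (cases "Suc r = p")
    case True
    \<comment> \<open>At the wrap-around class \<open>p\<close> is unshifted, so tightness makes the
      two means differ by exactly 1, a difference that \<open>R\<close> ignores.\<close>
    then have "CM p d e h 0 = CM p d e h r + 1"
      using that S(3)[of r] moment_1_p[of h] by (simp add: moment_1_class del: One_nat_def)
    then have "CM p d e h 0 - CM p d e h r0 = (CM p d e h r - CM p d e h r0) + 1" by simp
    moreover have "x + 1 \<in> \<int> \<longleftrightarrow> x \<in> \<int>" for x :: real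
      using Ints_add[of x 1] Ints_diff[of "x + 1" 1] by auto
    ultimately have "R 0 \<longleftrightarrow> R r" unfolding R_def by (simp only:)
    then show ?thesis
      using True that moment_1_p[of v] v0 CMv p_pos by (simp add: moment_1_class del: One_nat_def)
  next
    case False
    then have "Suc r < p" using that(1) by simp
    then have "CM p d e h (Suc r) = CM p d e h r"
      using that S(3) by (simp add: moment_1_class del: One_nat_def)
    then show ?thesis
      using \<open>Suc r < p\<close> that v0 CMv by (simp add: R_def moment_1_class del: One_nat_def)
  qed
  \<comment> \<open>Where \<open>f r j\<close> is nonzero, \<open>j\<close> is \<open>a r\<close> or
    \<open>b r\<close>, and the entry of \<open>h\<close> there is positive.\<close>
  have "\<forall>\<^sub>F x in at_right 0. (\<forall>r\<in>{..<p}. \<forall>j\<in>{..d}.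
      0 \<le> mod_entry p e h r j + x * f r j \<and> 0 \<le> mod_entry p e h r j - x * f r j)"
  proof (intro eventually_ball_finite ballI)
    fix r j assume "r \<in> {..<p}" "j \<in> {..d}"
    then show "\<forall>\<^sub>F x in at_right 0.
        0 \<le> mod_entry p e h r j + x * f r j \<and> 0 \<le> mod_entry p e h r j - x * f r j"
      using S(2)[of r j] ab[of r] by (intro eventually_perturbation_nonneg) (auto simp: f_def)
  qed auto
  moreover have "\<forall>\<^sub>F x in at_right 0. (\<forall>r\<in>{..<p}.
      0 \<le> (moment 1 h r - moment 1 h (Suc r)) + x * (moment 1 v r - moment 1 v (Suc r)) \<and>
      0 \<le> (moment 1 h r - moment 1 h (Suc r)) - x * (moment 1 v r - moment 1 v (Suc r)))"
  proof (intro eventually_ball_finite ballI eventually_perturbation_nonneg)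
    fix r assume r: "r \<in> {..<p}"
    show "0 \<le> moment 1 h r - moment 1 h (Suc r)" using S(1) d r by (simp add: balanced_def)
    show "moment 1 v r - moment 1 v (Suc r) = 0" if "moment 1 h r - moment 1 h (Suc r) = 0"
      using v1_eq[of r] r that by simp
  qed auto
  moreover have "\<forall>\<^sub>F x in at_right (0::real). 0 < x" by (simp add: eventually_at_right_less)
  ultimately have "\<forall>\<^sub>F x in at_right 0. 0 < x \<and> h + x *\<^sub>R v \<in> S1 p d e \<and> h + (- x) *\<^sub>R v \<in> S1 p d e"
  proof eventually_elim
    case (elim x)
    have "h + y *\<^sub>R v \<in> S1 p d e" if y: "y = x \<or> y = - x" for y
    proof (rule S1_I[OF d])
      show "moment 0 (h + y *\<^sub>R v) 0 = 1" using S(3)[of 0] v0[of 0] by (simp add: moment_add moment_scaleR)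
      show "0 \<le> mod_entry p e (h + y *\<^sub>R v) r j" if "r < p" "j \<le> d" for r j
        using elim(1) y that v[OF that] by (auto simp: mod_entry_def)
      have "moment 1 (h + y *\<^sub>R v) (Suc r) \<le> moment 1 (h + y *\<^sub>R v) r" if "r < p" for r
        using elim(2) y that
        by (auto simp: moment_add moment_scaleR algebra_simps simp del: One_nat_def)
      moreover have "moment 0 (h + y *\<^sub>R v) (Suc r) = moment 0 (h + y *\<^sub>R v) r" if "r < p" for r
        using that S(3) v0 by (simp add: moment_add moment_scaleR)
      ultimately show "balanced (h + y *\<^sub>R v)" by (simp add: balanced_def del: One_nat_def)
    qed
    then show ?case using elim(3) by blast
  qed
  then obtain x where x: "0 < x" "h + x *\<^sub>R v \<in> S1 p d e" "h + (- x) *\<^sub>R v \<in> S1 p d e"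
    using eventually_happens[of _ "at_right (0::real)"] by auto
  have "v \<noteq> 0" using CMv[OF r0] by (auto simp: R_def CM_def mod_entry_def)
  then have "h + x *\<^sub>R v \<noteq> h + (- x) *\<^sub>R v" using x(1) by (simp add: eq_neg_iff_add_eq_0 flip: scaleR_add_left)
  moreover have "h = midpoint (h + x *\<^sub>R v) (h + (- x) *\<^sub>R v)"
    by (simp add: midpoint_def scaleR_add_right flip: scaleR_add_left)
  ultimately have "h \<in> open_segment (h + x *\<^sub>R v) (h + (- x) *\<^sub>R v)"
    using midpoint_in_open_segment by metis
  then show False using h x(2,3) by (simp add: extreme_point_of_def)
qed

text \<open>The first moments are integers and fall weakly by 1 in total, so a strict drop is a drop
  by 1 and leaves no room for another.\<close>

lemma offset_index_eqI:
  assumes h: "h extreme_point_of S1 p d e" and d: "1 \<le> d"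
    and r: "r < p" and drop: "moment 1 h (Suc r) < moment 1 h r"
  shows "offset_index p (CM p d e h) = r"
proof -
  have hS: "h \<in> S1 p d e" using h by (simp add: extreme_point_of_def)
  note S = S1_D[OF hS]
  note mono = moment_1_antimono[OF S(1) d]
  have m1: "moment 1 h q = CM p d e h q + 1" if "q < p" for q
    using that S(3)[of q] moment_1_class[OF that, of h] by simp
  have total: "moment 1 h 0 = moment 1 h p + 1" using m1[of 0] moment_1_p[of h] p_pos by simp
  have int: "moment 1 h q \<in> \<int>" if "q \<le> p" for q
  proof (cases "q = p")
    case True
    then show ?thesis using extreme_point_CM_in_Ints[OF h d, of 0] moment_1_p[of h] p_pos by simp
  next
    case False
    then show ?thesis using extreme_point_CM_in_Ints[OF h d, of q] m1[of q] that by simp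
  qed
  have "moment 1 h (Suc r) + 1 \<le> moment 1 h r"
    using int[of r] int[of "Suc r"] drop r by (auto elim!: Ints_cases)
  moreover have "moment 1 h r \<le> moment 1 h 0" "moment 1 h p \<le> moment 1 h (Suc r)"
    using mono r by auto
  ultimately have drop1: "moment 1 h r = moment 1 h (Suc r) + 1" using total by linarith
  have uniq: "q = r" if q: "is_offset p (CM p d e h) q" for q
  proof (rule ccontr)
    assume "q \<noteq> r"
    have qp: "Suc q < p" using q by (simp add: is_offset_def)
    have dropq: "moment 1 h q = moment 1 h (Suc q) + 1"
      using q m1[of q] m1[of "Suc q"] qp by (auto simp: is_offset_def)
    consider "Suc q \<le> r" | "Suc r \<le> q" using \<open>q \<noteq> r\<close> by linarith
    then show False
    proof cases
      case 1
      then have "moment 1 h r \<le> moment 1 h (Suc q)" "moment 1 h q \<le> moment 1 h 0"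
        "moment 1 h p \<le> moment 1 h (Suc r)"
        using mono r by auto
      then show False using dropq drop1 total by linarith
    next
      case 2
      then have "moment 1 h q \<le> moment 1 h (Suc r)" "moment 1 h r \<le> moment 1 h 0"
        "moment 1 h p \<le> moment 1 h (Suc q)"
        using mono r qp by auto
      then show False using dropq drop1 total by linarith
    qed
  qed
  show ?thesis
  proof (cases "Suc r < p")
    case True
    have "CM p d e h (Suc r) \<in> \<int>" by (rule extreme_point_CM_in_Ints[OF h d True])
    then obtain k where "CM p d e h (Suc r) = of_int k" by (auto elim: Ints_cases)
    moreover have "CM p d e h r = CM p d e h (Suc r) + 1" using m1 True r drop1 by simp
    ultimately have "is_offset p (CM p d e h) r" using True by (auto simp: is_offset_def)
    then show ?thesis using uniq unfolding offset_index_def by (metis the_equality)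
  next
    \<comment> \<open>Here \<open>r = p - 1\<close>: the drop is at the wrap-around, which
      \<open>is_offset\<close> excludes, and the default value \<open>p - 1\<close> of the offset
      index is the right one.\<close>
    case False
    then have "\<nexists>q. is_offset p (CM p d e h) q" using uniq by (auto simp: is_offset_def)
    then show ?thesis using False r by (simp add: offset_index_def)
  qed
qed

lemma ent_nonneg:
  assumes "h \<in> S1 p d e" "r \<le> p" "m \<le> Suc d"
  shows "0 \<le> ent h r m"
  using assms S1_D(2)[OF assms(1)] p_pos by (auto simp: ent_def split: nat.split)

text \<open>With equal first moments, the point mass in class \<open>r + 1\<close> has smaller variance than class \<open>r\<close>,
  and the coefficient of \<open>t\<^bsup>d - 2\<^esup>\<close> makes \<open>L_h\<close> decrease from class \<open>r\<close> to class \<open>r + 1\<close>.\<close>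

lemma moment_1_drop:
  assumes hS: "h \<in> S1 p d e" and hC: "h \<in> C_END p d e" and d: "1 \<le> d"
    and r: "r < p" and j: "j \<le> d" and z: "ent h r (Suc j) = 0" and o: "ent h (Suc r) (Suc j) = 1"
  shows "moment 1 h (Suc r) < moment 1 h r"
proof (rule ccontr)
  assume neg: "\<not> ?thesis"
  note S = S1_D[OF hS]
  have m0: "moment 0 h q = 1" if "q \<le> p" for q using S(3) that .
  have m1: "moment 1 h (Suc r) = moment 1 h r"
    using neg S(1) d r by (force simp: balanced_def)
  have point: "ent h (Suc r) m = (if m = Suc j then 1 else 0)" if "m \<le> Suc d" for m
  proof -
    have "(\<Sum>i\<in>{..Suc d} - {Suc j}. ent h (Suc r) i) = 0"
      using m0[of "Suc r"] r j o sum.remove[of "{..Suc d}" "Suc j" "ent h (Suc r)"]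
      by (simp add: moment_def)
    then have "\<forall>i\<in>{..Suc d} - {Suc j}. ent h (Suc r) i = 0"
      using ent_nonneg[OF hS] r by (subst (asm) sum_nonneg_eq_0_iff) auto
    then show ?thesis using that o by auto
  qed
  define c where "c m = ent h (Suc r) m - ent h r m" for m
  have c0: "(\<Sum>m\<le>Suc d. c m) = 0" and c1: "(\<Sum>m\<le>Suc d. real m * c m) = 0"
    using moment_diff[of 0 h r] moment_diff[of 1 h r] m0 r m1 by (simp_all add: c_def)
  \<comment> \<open>The quadratic is centred at the point mass \<open>Suc j\<close>; its linear and
    constant remainders vanish against \<open>c\<close> by \<open>c1\<close> and
    \<open>c0\<close>.\<close>
  have choose2: "2 * real (m choose 2) = (real m - real (Suc j))\<^sup>2 + (2 * real (Suc j) - 1) * real m - (real (Suc j))\<^sup>2"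
    for m
  proof -
    have "real (m choose 2) = real m * (real m - 1) / 2"
      by (simp add: binomial_gbinomial gbinomial_prod_rev numeral_2_eq_2 algebra_simps)
    then show ?thesis by (simp add: power2_eq_square algebra_simps)
  qed
  have "(\<Sum>m\<le>Suc d. 2 * real (m choose 2) * c m) = (\<Sum>m\<le>Suc d.
      (real m - real (Suc j))\<^sup>2 * c m + (2 * real (Suc j) - 1) * (real m * c m) - (real (Suc j))\<^sup>2 * c m)"
    unfolding choose2 by (simp only: left_diff_distrib distrib_right mult.assoc)
  also have "\<dots> = (\<Sum>m\<le>Suc d. (real m - real (Suc j))\<^sup>2 * c m)"
    unfolding sum.distrib sum_subtractf sum_distrib_left[symmetric] c0 c1 by simp
  \<comment> \<open>The square vanishes at the point mass, so only the variance of class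
    \<open>r\<close> remains, with a minus sign.\<close>
  also have "\<dots> = (\<Sum>m\<le>Suc d. - ((real m - real (Suc j))\<^sup>2 * ent h r m))"
    by (rule sum.cong) (auto simp: c_def point z)
  finally have var: "2 * (\<Sum>m\<le>Suc d. real (m choose 2) * c m)
      = - (\<Sum>m\<le>Suc d. (real m - real (Suc j))\<^sup>2 * ent h r m)"
    by (simp add: sum_distrib_left sum_negf mult.assoc del: sum.atMost_Suc)
  obtain m where m: "m \<le> Suc d" "ent h r m \<noteq> 0"
  proof -
    have "(\<Sum>m\<le>Suc d. ent h r m) \<noteq> 0" using m0[of r] r by (simp add: moment_def)
    then show ?thesis using that sum.not_neutral_contains_not_neutral by (metis atMost_iff)
  qed
  have pos: "0 < (\<Sum>m\<le>Suc d. (real m - real (Suc j))\<^sup>2 * ent h r m)"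
  proof (rule sum_pos2)
    show "0 < (real m - real (Suc j))\<^sup>2 * ent h r m"
      using m z ent_nonneg[OF hS _ m(1), of r] r by (cases "m = Suc j") (auto simp del: of_nat_Suc)
  qed (use m ent_nonneg[OF hS] r in auto)
  \<comment> \<open>For \<open>d = 1\<close> the difference \<open>c\<close> lives on the indices 1
    and 2, and two vanishing moments force it to be zero there, contrary to
    \<open>c (Suc j) = 1\<close>.\<close>
  have "2 \<le> d"
  proof (rule ccontr)
    assume "\<not> 2 \<le> d"
    then have d1: "d = 1" using d by simp
    have "c 0 = 0" using r point[of 0] by (simp add: c_def ent_def)
    moreover have "c 0 + c 1 + c 2 = 0" "c 1 + 2 * c 2 = 0"
      using c0 c1 by (simp_all add: d1 numeral_2_eq_2)
    ultimately have "c 1 = 0" "c 2 = 0" by linarith+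
    moreover have "Suc j = 1 \<or> Suc j = 2" using j d1 by linarith
    ultimately have "c (Suc j) = 0" by metis
    then show False using z o by (simp add: c_def)
  qed
  have "0 \<le> (- 1) ^ 2 * (\<Sum>m\<le>Suc d. real (m choose 2) * c m)"
  proof (rule binomial_combination_nonneg_imp[OF \<open>2 \<le> d\<close>])
    show "(\<Sum>m\<le>Suc d. real (m choose i) * c m) = 0" if "i < 2" for i
      using that c0 c1 by (auto simp: less_2_cases_iff simp del: sum.atMost_Suc)
    show "\<forall>\<^sub>F t in sequentially. 0 \<le> (\<Sum>m\<le>Suc d. c m * real ((t + d - m) choose d))"
      using hC r unfolding C_END_iff c_def by blast
  qed
  with var pos show False by (simp del: sum.atMost_Suc)
qed

end

theorem proposition6p2:
  fixes d p :: nat and e :: "nat \<Rightarrow> 'n::finite" and h :: "real ^ 'n"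
  assumes "p \<ge> 1"
    and "bij_betw e {..<p * (d + 1)} UNIV"
    and "h extreme_point_of S1 p d e"
    and "\<exists>i. i + 1 \<le> p * (d + 1) - 1 \<and> \<not> [i = offset_index p (CM p d e h)] (mod p) \<and>
           h $ e i = 0 \<and> h $ e (i + 1) = 1"
  shows "h \<notin> C_END p d e"
proof
  assume hC: "h \<in> C_END p d e"
  interpret indexed_space p d e using assms(1,2) by unfold_locales
  have hS: "h \<in> S1 p d e" using assms(3) by (simp add: extreme_point_of_def)
  obtain i where i: "i + 1 \<le> p * (d + 1) - 1" "\<not> [i = offset_index p (CM p d e h)] (mod p)"
    "h $ e i = 0" "h $ e (i + 1) = 1" using assms(4) by blast
  define r j where "r = i mod p" and "j = i div p"
  have r: "r < p" and ij: "i = j * p + r" using p_pos by (auto simp: r_def j_def)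
  have "i < p * (d + 1)" using i(1) p_pos by simp
  then have j: "j \<le> d" by (simp add: j_def less_mult_imp_div_less mult.commute flip: less_Suc_eq_le)
  have z: "ent h r (Suc j) = 0" using r i(3) by (simp add: ent_def mod_entry_def ij)
  \<comment> \<open>If \<open>i\<close> is in class \<open>p - 1\<close>, then \<open>i + 1\<close>
    opens the next block. It must be within range, since \<open>ent\<close> cuts class
    \<open>p\<close> off above \<open>d\<close>.\<close>
  have "Suc j \<le> d" if "Suc r = p"
  proof -
    have "Suc j * p = i + 1" using that ij by simp
    also have "\<dots> < Suc d * p" using i(1) p_pos by (simp add: mult.commute)
    finally show ?thesis by simp
  qed
  then have o: "ent h (Suc r) (Suc j) = 1"
    using i(4) by (auto simp: ent_def mod_entry_def ij add_ac)
  show False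
  proof (cases "d = 0")
    case True
    \<comment> \<open>For \<open>d = 0\<close> a class is a single entry, which its mass forces to
      be 1, against \<open>h $ e i = 0\<close>.\<close>
    then have "j = 0" using j by simp
    moreover have "(\<Sum>j\<le>d. mod_entry p e h r j) = 1"
      using S1_D(3)[OF hS, of r] r by (simp add: moment_0_class)
    moreover have "mod_entry p e h r j = 0" using i(3) by (simp add: mod_entry_def ij)
    ultimately show False using True by simp
  next
    case False
    then have d: "1 \<le> d" by simp
    have "offset_index p (CM p d e h) = r"
      by (rule offset_index_eqI[OF assms(3) d r moment_1_drop[OF hS hC d r j z o]])
    then show False using i(2) by (simp add: r_def cong_def)
  qed
qed

end
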